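(* Let $\mathcal C\subset\mathbb R^d$ be a relatively open convex set and let $\mathcal Q\subset\mathbb R^d$ be a relatively open set such that $\mathrm{dir}(\mathcal X^\star(\mathcal C))\subset\mathrm{dir}(\mathcal C)^\perp+\mathrm{span}\,\mathcal Q$. Then the smallest cardinality of a sufficient decision dataset $\mathcal D\subset\mathcal Q$ (for uncertainty set $\mathcal C$ and decision set $\mathcal X$) is either $r(\mathcal X,\mathcal C)$ or $r(\mathcal X,\mathcal C)+1$.
   Context: Let $A\in\mathbb R^{m\times d}$, $b\in\mathbb R^m$, and let $\mathcal X=\{x\in\mathbb R^d: Ax=b,\ x\ge 0\}$, assumed bounded. A finite set $\mathcal D=\{q_1,\dots,q_N\}$ is a sufficient decision dataset for $\mathcal C$ and $\mathcal X$ if there is a map $\hat X:\mathbb R^N\to\mathcal P(\mathcal X)$ (the set of subsets of $\mathcal X$) such that $\hat X(c^\top q_1,\dots,c^\top q_N)=\arg\min_{x\in\mathcal X}c^\top x$ for all $c\in\mathcal C$. $\mathcal X^\star(\mathcal C)=\bigcup_{c\in\mathcal C}\arg\min_{x\in\mathcal X}c^\top x$. For $S\subset\mathbb R^d$, $\mathrm{dir}(S)=\mathrm{span}\{x_1-x_2:x_1,x_2\in S\}$. $S$ is relatively open if every $x\in S$ has some $\varepsilon>0$ with $B(x,\varepsilon)\cap\mathrm{Aff}(S)\subset S$ ($\mathrm{Aff}(S)$ the affine hull, $B(x,\varepsilon)$ the open Euclidean ball). With $\mathrm{proj}_W$ the orthogonal projection onto $W$, $$r(\mathcal X,\mathcal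 C)=\dim\mathrm{proj}_{\mathrm{dir}(\mathcal C)}\big(\mathrm{dir}(\mathcal X^\star(\mathcal C))\big)=\dim\mathrm{dir}(\mathcal X^\star(\mathcal C))-\dim\big(\mathrm{dir}(\mathcal X^\star(\mathcal C))\cap\mathrm{dir}(\mathcal C)^\perp\big).$$ *)

theory Defs
  imports "HOL-Analysis.Analysis"
begin

definition standard_polyhedron :: "real^'d^'m \<Rightarrow> real^'m \<Rightarrow> (real^'d) set" where
  "standard_polyhedron A b = {x. A *v x = b \<and> (\<forall>i. 0 \<le> x $ i)}"

definition argmin_set :: "'a::euclidean_space set \<Rightarrow> 'a \<Rightarrow> 'a set" where
  "argmin_set X c = {x. is_arg_min (\<lambda>y. c \<bullet> y) (\<lambda>y. y \<in> X) x}"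

text \<open>
  The list \<^term>\<open>qs\<close> is an enumeration \<open>q_1, \<dots>, q_N\<close> of \<^term>\<open>D\<close>, so that real lists of
  length \<open>N\<close> play the role of the vectors in \<open>\<real>\<^sup>N\<close> on which the decision map is defined.
\<close>

definition sufficient_dataset ::
    "'a::euclidean_space set \<Rightarrow> 'a set \<Rightarrow> 'a set \<Rightarrow> bool" where
  "sufficient_dataset C X D \<longleftrightarrow>
     (\<exists>qs. distinct qs \<and> set qs = D \<and>
       (\<exists>Xhat \<in> {ys :: real list. length ys = length qs} \<rightarrow> Pow X.
          \<forall>c\<in>C. Xhat (map (\<lambda>q. c \<bullet> q) qs) = argmin_set X c))"

definition optimal_solutions :: "'a::euclidean_space set \<Rightarrow> 'a set \<Rightarrow> 'a set" where
  "optimal_solutions X C = (\<Union>c\<in>C. argmin_set X c)"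

definition dir :: "'a::euclidean_space set \<Rightarrow> 'a set" where
  "dir S = span {x1 - x2 | x1 x2. x1 \<in> S \<and> x2 \<in> S}"

definition orth_proj :: "'a::euclidean_space set \<Rightarrow> 'a \<Rightarrow> 'a" where
  "orth_proj W x = (THE p. p \<in> W \<and> x - p \<in> orthogonal_comp W)"

definition decision_rank :: "'a::euclidean_space set \<Rightarrow> 'a set \<Rightarrow> nat" where
  "decision_rank X C = dim (orth_proj (dir C) ` dir (optimal_solutions X C))"

lemma subspace_dir: "subspace (dir S)"
  by (simp add: dir_def)

lemma rel_open_iff_ball:
  fixes S :: "'a::euclidean_space set"
  shows "rel_open S \<longleftrightarrow> (\<forall>x\<in>S. \<exists>e>0. ball x e \<inter> affine hull S \<subseteq> S)"
proof -
  have "rel_open S \<longleftrightarrow> (\<forall>x\<in>S. x \<in> rel_interior S)"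
    unfolding rel_open_def using rel_interior_subset[of S] by blast
  then show ?thesis by (simp add: mem_rel_interior_ball)
qed

lemma orth_proj_props:
  fixes W :: "'a::euclidean_space set"
  assumes "subspace W"
  shows "orth_proj W x \<in> W" "x - orth_proj W x \<in> orthogonal_comp W"
proof -
  have ex: "\<exists>p. p \<in> W \<and> x - p \<in> orthogonal_comp W"
  proof -
    obtain y z where "y \<in> span W" "\<And>w. w \<in> span W \<Longrightarrow> orthogonal z w" "x = y + z"
      using orthogonal_subspace_decomp_exists[of W x] by metis
    moreover have "span W = W" using assms by (simp add: span_eq_iff)
    ultimately have "y \<in> W \<and> x - y \<in> orthogonal_comp W"
      by (auto simp: orthogonal_comp_def) (metis orthogonal_commute)
    then show ?thesis by blast
  qed
  have uniq: "p = p'" if "p \<in> W" "x - p \<in> orthogonal_comp W"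
      "p' \<in> W" "x - p' \<in> orthogonal_comp W" for p p'
  proof -
    have "p - p' \<in> W" using that assms by (simp add: subspace_diff)
    moreover have "(x - p') - (x - p) \<in> orthogonal_comp W"
      using that subspace_orthogonal_comp by (metis subspace_diff)
    ultimately have "orthogonal (p - p') (p - p')"
      by (auto simp: orthogonal_comp_def)
    then show ?thesis by (simp add: orthogonal_self)
  qed
  have "orth_proj W x \<in> W \<and> x - orth_proj W x \<in> orthogonal_comp W"
    unfolding orth_proj_def by (rule theI') (use ex uniq in blast)
  then show "orth_proj W x \<in> W" "x - orth_proj W x \<in> orthogonal_comp W" by auto
qed

lemma orth_proj_eqI:
  fixes W :: "'a::euclidean_space set"
  assumes "subspace W" "p \<in> W" "x - p \<in> orthogonal_comp W"
  shows "orth_proj W x = p"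
proof -
  note P = orth_proj_props[OF assms(1), of x]
  have "p - orth_proj W x \<in> W" using P assms by (simp add: subspace_diff)
  moreover have "(x - orth_proj W x) - (x - p) \<in> orthogonal_comp W"
    using P assms subspace_orthogonal_comp by (metis subspace_diff)
  ultimately have "orthogonal (p - orth_proj W x) (p - orth_proj W x)"
    by (auto simp: orthogonal_comp_def)
  then show ?thesis by (simp add: orthogonal_self)
qed

lemma linear_orth_proj:
  fixes W :: "'a::euclidean_space set"
  assumes "subspace W"
  shows "linear (orth_proj W)"
proof (rule linearI)
  fix x y :: 'a and r :: real
  note P = orth_proj_props[OF assms]
  have "(x - orth_proj W x) + (y - orth_proj W y) \<in> orthogonal_comp W"
    using P subspace_orthogonal_comp subspace_add by blast
  then show "orth_proj W (x + y) = orth_proj W x + orth_proj W y"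
    using P assms by (intro orth_proj_eqI) (auto simp: subspace_add algebra_simps)
  have "r *\<^sub>R (x - orth_proj W x) \<in> orthogonal_comp W"
    using P subspace_orthogonal_comp subspace_scale by blast
  then show "orth_proj W (r *\<^sub>R x) = r *\<^sub>R orth_proj W x"
    using P assms by (intro orth_proj_eqI) (auto simp: subspace_scale algebra_simps)
qed

lemma orth_proj_eq_0_iff:
  fixes W :: "'a::euclidean_space set"
  assumes "subspace W"
  shows "orth_proj W x = 0 \<longleftrightarrow> x \<in> orthogonal_comp W"
  using orth_proj_props[OF assms, of x] orth_proj_eqI[OF assms, of 0 x] subspace_0[OF assms]
  by auto

lemma decision_rank_eq:
  fixes X C :: "'a::euclidean_space set"
  shows "decision_rank X C = dim (dir (optimal_solutions X C))
           - dim (dir (optimal_solutions X C) \<inter> orthogonal_comp (dir C))"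
proof -
  define V where "V = dir (optimal_solutions X C)"
  define P where "P = orth_proj (dir C)"
  define K where "K = V \<inter> orthogonal_comp (dir C)"
  define U where "U = {y \<in> V. \<forall>x\<in>K. orthogonal x y}"
  have V: "subspace V" by (simp add: V_def subspace_dir)
  have K: "subspace K" by (simp add: K_def V subspace_inter subspace_orthogonal_comp)
  have linP: "linear P" by (simp add: P_def linear_orth_proj subspace_dir)
  have P0: "P x = 0 \<longleftrightarrow> x \<in> orthogonal_comp (dir C)" for x
    by (simp add: P_def orth_proj_eq_0_iff subspace_dir)
  have U: "subspace U"
    unfolding U_def using V
    by (auto simp: subspace_def orthogonal_clauses)
  have dimU: "dim U + dim K = dim V"
    unfolding U_def by (rule dim_subspace_orthogonal_to_vectors) (auto simp: K V, auto simp: K_def)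
  have "P ` V = P ` U"
  proof
    show "P ` V \<subseteq> P ` U"
    proof (rule image_subsetI)
      fix x assume x: "x \<in> V"
      obtain y z where yz: "y \<in> span K" "\<And>w. w \<in> span K \<Longrightarrow> orthogonal z w" "x = y + z"
        using orthogonal_subspace_decomp_exists[of K x] by metis
      have yK: "y \<in> K" using yz(1) K by (metis span_eq_iff)
      then have "y \<in> V" by (simp add: K_def)
      then have "z \<in> V" using x yz V by (metis add_diff_cancel_left' subspace_diff)
      then have "z \<in> U"
        using yz(2) by (auto simp: U_def orthogonal_commute span_base)
      moreover have "P x = P z"
        using yK yz(3) linP P0[of y] by (simp add: K_def linear_add)
      ultimately show "P x \<in> P ` U" by simp
    qed
  qed (auto simp: U_def)
  moreover have "inj_on P (span U)"
  proof (rule inj_onI)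
    fix x y assume xy: "x \<in> span U" "y \<in> span U" "P x = P y"
    then have U': "x - y \<in> U" using U by (metis span_eq_iff subspace_diff)
    moreover have "P (x - y) = 0" using xy linP by (simp add: linear_diff)
    ultimately have "x - y \<in> K" by (auto simp: P0 K_def U_def)
    then have "orthogonal (x - y) (x - y)" using U' by (auto simp: U_def)
    then show "x = y" by (simp add: orthogonal_self)
  qed
  ultimately have "dim (P ` V) = dim U"
    using dim_image_eq[OF linP, of U] by simp
  then show ?thesis
    using dimU by (simp add: decision_rank_def V_def P_def K_def)
qed

end

theory Submission
  imports Defs
begin

text \<open>
  Only the component of \<open>c\<close> along \<open>dir C\<close> varies, so \<open>D\<close> is sufficient iff every direction
  \<open>l \<in> dir C\<close> that is orthogonal to \<open>D\<close> is orthogonal to \<open>V = dir (optimal_solutions X C)\<close>. For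
  necessity, moving \<open>c\<close> along \<open>l\<close> does not change the minimizers, so \<open>l \<bullet> x\<close> is constant on each
  minimizing face; since the minimizing faces of a polytope can only shrink under small
  perturbations of \<open>c\<close>, this constant is locally constant in \<open>c\<close>, hence constant on the connected
  set \<open>C\<close>. It follows that \<open>D\<close> is sufficient iff the projection of \<open>V\<close> to \<open>dir C\<close> lies in the span
  of the projection of \<open>D\<close>, whence the lower bound. For the upper bound fix \<open>q0 \<in> Q\<close> and lift a
  basis of the projection of \<open>V\<close> to vectors \<open>a *\<^sub>R q0 + t\<close> with \<open>t \<in> dir Q\<close>; the points \<open>q0\<close> and
  \<open>q0 + e *\<^sub>R t\<close>, with \<open>e\<close> small, are then sufficient.
\<close>

section \<open>Minimizers of linear functionals over a polytope\<close>

lemma mem_argmin_set: "x \<in> argmin_set X c \<longleftrightarrow> x \<in> X \<and> (\<forall>y\<in>X. c \<bullet> x \<le> c \<bullet> y)"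
  by (auto simp: argmin_set_def is_arg_min_linorder)

lemma argmin_set_nonempty:
  assumes "compact X" "X \<noteq> {}"
  shows "argmin_set X c \<noteq> {}"
proof -
  have "continuous_on X (\<lambda>x. c \<bullet> x)" by (intro continuous_intros)
  then show ?thesis
    using continuous_attains_inf[OF assms, of "\<lambda>x. c \<bullet> x"] mem_argmin_set by blast
qed

text \<open>The last hypothesis says that passing from \<open>x'\<close> to \<open>x\<close> changes
  both costs by the same amount. Optimality makes this change \<le> 0 under \<open>c\<close> and
  \<ge> 0 under \<open>c'\<close>, so it is zero.\<close>

lemma argmin_set_add_orthogonal:
  assumes "x \<in> argmin_set X c" "x' \<in> argmin_set X c'" "(c' - c) \<bullet> (x - x') = 0"
  shows "x \<in> argmin_set X c'"
proof -
  have "c \<bullet> x \<le> c \<bullet> x'" "c' \<bullet> x' \<le> c' \<bullet> x"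
    using assms(1,2) by (auto simp: mem_argmin_set)
  with assms(3) have "c' \<bullet> x = c' \<bullet> x'" by (simp add: inner_diff)
  with assms(1,2) show ?thesis by (auto simp: mem_argmin_set)
qed

lemma polyhedron_standard_polyhedron:
  fixes A :: "real^'d^'m"
  shows "polyhedron (standard_polyhedron A b)"
proof -
  have "standard_polyhedron A b =
      (\<Inter>i. {x. A $ i \<bullet> x = b $ i}) \<inter> (\<Inter>i. {x. axis i 1 \<bullet> x \<ge> 0})"
    by (auto simp: standard_polyhedron_def matrix_vector_mul_component vec_eq_iff inner_axis')
  moreover have "polyhedron (\<Inter>i. {x. A $ i \<bullet> x = b $ i})"
    by (rule polyhedron_Inter) (auto simp: polyhedron_hyperplane)
  moreover have "polyhedron (\<Inter>i. {x::real^'d. axis i 1 \<bullet> x \<ge> 0})"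
    by (rule polyhedron_Inter) (auto simp: polyhedron_halfspace_ge)
  ultimately show ?thesis by (simp only: polyhedron_Int)
qed

lemma convex_argmin_set:
  assumes "convex X"
  shows "convex (argmin_set X c)"
proof (cases "argmin_set X c = {}")
  case False
  then obtain x where x: "x \<in> argmin_set X c" by blast
  then have "argmin_set X c = X \<inter> {y. c \<bullet> y \<le> c \<bullet> x}"
    by (auto simp: mem_argmin_set) (meson order_trans)
  with assms show ?thesis by (simp add: convex_Int convex_halfspace_le)
qed simp

text \<open>A minimizer is a weighted average of points of \<open>F\<close> whose cost gaps are
  nonnegative. The weighted gaps sum to zero, so all weight sits on minimizing points. Minimizing
  faces are thereby controlled by finitely many points.\<close>

lemma argmin_set_convex_hull:
  assumes "finite F"
  shows "argmin_set (convex hull F) c = convex hull (F \<inter> argmin_set (convex hull F) c)"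
proof
  show "convex hull (F \<inter> argmin_set (convex hull F) c) \<subseteq> argmin_set (convex hull F) c"
    by (rule hull_minimal) (auto intro: convex_argmin_set)
next
  show "argmin_set (convex hull F) c \<subseteq> convex hull (F \<inter> argmin_set (convex hull F) c)"
  proof
    fix x assume x: "x \<in> argmin_set (convex hull F) c"
    then obtain u where u: "\<And>v. v \<in> F \<Longrightarrow> 0 \<le> u v" "sum u F = 1" "(\<Sum>v\<in>F. u v *\<^sub>R v) = x"
      using assms by (auto simp: mem_argmin_set convex_hull_finite)
    have ge: "c \<bullet> x \<le> c \<bullet> v" if "v \<in> F" for v
      using x that by (simp add: mem_argmin_set hull_inc)
    have "(\<Sum>v\<in>F. u v * (c \<bullet> v - c \<bullet> x)) = c \<bullet> (\<Sum>v\<in>F. u v *\<^sub>R v) - sum u F * (c \<bullet> x)"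
      by (simp add: inner_sum_right sum_distrib_right right_diff_distrib sum_subtractf)
    also have "\<dots> = 0" using u by simp
    finally have "\<forall>v\<in>F. u v * (c \<bullet> v - c \<bullet> x) = 0"
      using assms u(1) ge by (subst (asm) sum_nonneg_eq_0_iff) auto
    then have supp: "u v = 0" if "v \<in> F" "v \<notin> argmin_set (convex hull F) c" for v
      using that x by (force simp: mem_argmin_set hull_inc)
    have "sum u (F \<inter> argmin_set (convex hull F) c) = 1"
      using u(2) supp assms by (subst sum.mono_neutral_left[of F]) auto
    moreover have "(\<Sum>v\<in>F \<inter> argmin_set (convex hull F) c. u v *\<^sub>R v) = x"
      using u(3) supp assms by (subst sum.mono_neutral_left[of F]) auto
    ultimately show "x \<in> convex hull (F \<inter> argmin_set (convex hull F) c)"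
      using u(1) assms by (auto simp: convex_hull_finite)
  qed
qed

text \<open>A generator that is not optimal for \<open>c\<close> costs strictly more than a fixed
  minimizer \<open>x\<close>, and this strict inequality survives small changes of \<open>c\<close>.
  Since there are finitely many generators, one neighbourhood serves them all.\<close>

lemma eventually_argmin_set_subset:
  fixes X :: "'a::euclidean_space set"
  assumes "polytope X"
  shows "\<forall>\<^sub>F c' in nhds c. argmin_set X c' \<subseteq> argmin_set X c"
proof (cases "X = {}")
  case False
  obtain F where F: "finite F" "X = convex hull F"
    using assms by (auto simp: polytope_def)
  obtain x where x: "x \<in> argmin_set X c"
    using argmin_set_nonempty assms False polytope_imp_compact by blast
  have "\<forall>\<^sub>F c' in nhds c. v \<notin> argmin_set X c'" if "v \<in> F - argmin_set X c" for v
  proof -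
    have "c \<bullet> x < c \<bullet> v"
      using that x F by (force simp: mem_argmin_set hull_inc)
    then have "\<forall>\<^sub>F c' in nhds c. c' \<bullet> (v - x) > 0"
      by (intro order_tendstoD(1)[where y = "c \<bullet> (v - x)"] tendsto_intros filterlim_ident)
        (simp add: inner_diff)
    then show ?thesis
      by eventually_elim (use x in \<open>force simp: mem_argmin_set inner_diff\<close>)
  qed
  then have "\<forall>\<^sub>F c' in nhds c. \<forall>v\<in>F - argmin_set X c. v \<notin> argmin_set X c'"
    using F(1) by (simp add: eventually_ball_finite)
  then show ?thesis
  proof eventually_elim
    case (elim c')
    then have "F \<inter> argmin_set X c' \<subseteq> F \<inter> argmin_set X c" by blast
    then show ?case
      using argmin_set_convex_hull[OF F(1)] hull_mono unfolding F(2) by metis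
  qed
qed (simp add: argmin_set_def is_arg_min_def)

section \<open>Direction spaces and relatively open sets\<close>

lemma dir_eq_span_diff:
  assumes "a \<in> S"
  shows "dir S = span ((\<lambda>x. x - a) ` S)"
proof
  have "x1 - x2 \<in> span ((\<lambda>x. x - a) ` S)" if "x1 \<in> S" "x2 \<in> S" for x1 x2
  proof -
    have "(x1 - a) - (x2 - a) \<in> span ((\<lambda>x. x - a) ` S)"
      using that by (intro span_diff span_base) auto
    then show ?thesis by simp
  qed
  then show "dir S \<subseteq> span ((\<lambda>x. x - a) ` S)"
    unfolding dir_def by (intro span_minimal) auto
  show "span ((\<lambda>x. x - a) ` S) \<subseteq> dir S"
    unfolding dir_def using assms by (intro span_mono) auto
qed

lemma rel_open_move:
  fixes S :: "'a::euclidean_space set"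
  assumes "rel_open S" "a \<in> S" "l \<in> dir S"
  obtains e where "e > 0" "a + e *\<^sub>R l \<in> S"
proof -
  obtain e where e: "e > 0" "ball a e \<inter> affine hull S \<subseteq> S"
    using assms(1,2) rel_open_iff_ball by blast
  \<comment> \<open>The \<open>+ 1\<close> keeps the denominator positive for \<open>l = 0\<close>
    and gives the strict bound \<open>d * norm l < e\<close>.\<close>
  define d where "d = e / (norm l + 1)"
  have d: "d > 0" using e(1) by (simp add: d_def add_nonneg_pos)
  have "d * norm l < d * (norm l + 1)" using d by simp
  also have "\<dots> = e" by (simp add: d_def add_nonneg_eq_0_iff)
  finally have "a + d *\<^sub>R l \<in> ball a e" using d by (simp add: dist_norm)
  moreover have "a + d *\<^sub>R l \<in> affine hull S"
  proof -
    have "d *\<^sub>R l \<in> span ((\<lambda>x. x - a) ` S)"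
      using assms(2,3) dir_eq_span_diff span_scale by blast
    then show ?thesis
      by (auto simp: diffs_affine_hull_span[OF assms(2), symmetric] algebra_simps)
  qed
  ultimately show thesis using d e(2) that by blast
qed

lemma orthogonal_dir_iff:
  assumes "a \<in> S"
  shows "(\<forall>v\<in>dir S. l \<bullet> v = 0) \<longleftrightarrow> (\<forall>x\<in>S. l \<bullet> x = l \<bullet> a)"
proof
  assume "\<forall>v\<in>dir S. l \<bullet> v = 0"
  moreover have "x - a \<in> dir S" if "x \<in> S" for x
    using that assms by (auto simp: dir_def intro!: span_base)
  ultimately show "\<forall>x\<in>S. l \<bullet> x = l \<bullet> a" by (force simp: inner_diff_right)
next
  assume *: "\<forall>x\<in>S. l \<bullet> x = l \<bullet> a"
  have "dir S \<subseteq> {v. l \<bullet> v = 0}"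
    unfolding dir_def using * by (intro span_minimal subspace_hyperplane) (auto simp: inner_diff_right)
  then show "\<forall>v\<in>dir S. l \<bullet> v = 0" by blast
qed

section \<open>Sufficiency and directions orthogonal to the dataset\<close>

lemma sufficient_dataset_iff:
  "sufficient_dataset C X D \<longleftrightarrow> finite D \<and>
     (\<forall>c\<in>C. \<forall>c'\<in>C. (\<forall>q\<in>D. c \<bullet> q = c' \<bullet> q) \<longrightarrow> argmin_set X c = argmin_set X c')"
    (is "?L \<longleftrightarrow> ?R")
proof
  assume ?L
  then obtain qs Xhat where qs: "set qs = D"
    and Xhat: "\<forall>c\<in>C. Xhat (map (\<lambda>q. c \<bullet> q) qs) = argmin_set X c"
    unfolding sufficient_dataset_def by blast
  have "argmin_set X c = argmin_set X c'"
    if "c \<in> C" "c' \<in> C" "\<forall>q\<in>D. c \<bullet> q = c' \<bullet> q" for c c'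
  proof -
    have "map (\<lambda>q. c \<bullet> q) qs = map (\<lambda>q. c' \<bullet> q) qs" using that qs by simp
    with Xhat that show ?thesis by metis
  qed
  with qs show ?R by blast
next
  assume R: ?R
  then obtain qs where qs: "distinct qs" "set qs = D" using finite_distinct_list by metis
  \<comment> \<open>All costs in \<open>C\<close> with measurements \<open>ys\<close> share their
    minimizers by \<open>R\<close>, so the union collapses to that common set; measurements of no
    cost in \<open>C\<close> get the empty set.\<close>
  define Xhat where
    "Xhat ys = X \<inter> \<Union>{argmin_set X c |c. c \<in> C \<and> map (\<lambda>q. c \<bullet> q) qs = ys}" for ys
  have "Xhat (map (\<lambda>q. c \<bullet> q) qs) = argmin_set X c" if c: "c \<in> C" for c
  proof -
    have "argmin_set X c' = argmin_set X c"
      if "c' \<in> C" "map (\<lambda>q. c' \<bullet> q) qs = map (\<lambda>q. c \<bullet> q) qs" for c'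
    proof -
      have "\<forall>q\<in>D. c' \<bullet> q = c \<bullet> q" using that qs by simp
      with R c that show ?thesis by blast
    qed
    then have "{argmin_set X c' |c'. c' \<in> C \<and> map (\<lambda>q. c' \<bullet> q) qs = map (\<lambda>q. c \<bullet> q) qs} =
        {argmin_set X c}"
      using c by blast
    then show ?thesis by (auto simp: Xhat_def mem_argmin_set)
  qed
  moreover have "Xhat \<in> {ys. length ys = length qs} \<rightarrow> Pow X" by (auto simp: Xhat_def)
  ultimately show ?L unfolding sufficient_dataset_def using qs by blast
qed

text \<open>Two costs with equal measurements differ by some \<open>l\<close> in
  \<open>dir C\<close> orthogonal to \<open>D\<close>. Differences of optimal solutions are then
  orthogonal to \<open>l\<close>, so \<open>argmin_set_add_orthogonal\<close> carries minimizers
  from either cost to the other.\<close>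

lemma sufficient_datasetI:
  fixes X C D :: "'a::euclidean_space set"
  assumes "compact X" "finite D"
    and orth: "\<And>l v. l \<in> dir C \<Longrightarrow> \<forall>q\<in>D. l \<bullet> q = 0 \<Longrightarrow> v \<in> dir (optimal_solutions X C) \<Longrightarrow> l \<bullet> v = 0"
  shows "sufficient_dataset C X D"
proof (cases "X = {}")
  case True
  then show ?thesis using assms(2) by (auto simp: sufficient_dataset_iff mem_argmin_set)
next
  case False
  have sub: "argmin_set X c \<subseteq> argmin_set X c'"
    if c: "c \<in> C" "c' \<in> C" "\<forall>q\<in>D. c \<bullet> q = c' \<bullet> q" for c c'
  proof
    fix x assume x: "x \<in> argmin_set X c"
    obtain x' where x': "x' \<in> argmin_set X c'"
      using argmin_set_nonempty assms(1) False by blast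
    have "c' - c \<in> dir C" using c by (auto simp: dir_def intro!: span_base)
    moreover have "x - x' \<in> dir (optimal_solutions X C)"
      using c x x' by (auto simp: dir_def optimal_solutions_def intro!: span_base)
    ultimately have "(c' - c) \<bullet> (x - x') = 0"
      using c by (intro orth) (auto simp: inner_diff_left)
    with x x' show "x \<in> argmin_set X c'" by (rule argmin_set_add_orthogonal)
  qed
  then have "argmin_set X c = argmin_set X c'"
    if "c \<in> C" "c' \<in> C" "\<forall>q\<in>D. c \<bullet> q = c' \<bullet> q" for c c'
    using that by (intro equalityI) simp_all
  with assms(2) show ?thesis unfolding sufficient_dataset_iff by blast
qed

lemma sufficient_dataset_orthogonal:
  fixes X C D :: "'a::euclidean_space set"
  assumes X: "polytope X" and C: "connected C" "rel_open C"
    and D: "sufficient_dataset C X D"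
    and l: "l \<in> dir C" "\<forall>q\<in>D. l \<bullet> q = 0"
    and v: "v \<in> dir (optimal_solutions X C)"
  shows "l \<bullet> v = 0"
proof (cases "optimal_solutions X C = {}")
  case True
  with v show ?thesis by (simp add: dir_def)
next
  case False
  then obtain c0 a where c0: "c0 \<in> C" "a \<in> argmin_set X c0"
    by (auto simp: optimal_solutions_def)
  then have "X \<noteq> {}" by (auto simp: mem_argmin_set)
  then have nonempty: "argmin_set X c \<noteq> {}" for c
    using argmin_set_nonempty X polytope_imp_compact by blast
  \<comment> \<open>The costs \<open>c\<close> and \<open>c + e *\<^sub>R l\<close> have the same
    minimizers and each is constant on them; subtracting leaves \<open>l\<close>.\<close>
  have const: "l \<bullet> x = l \<bullet> y" if c: "c \<in> C" and xy: "x \<in> argmin_set X c" "y \<in> argmin_set X c" for c x y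
  proof -
    obtain e where e: "e > 0" "c + e *\<^sub>R l \<in> C"
      using rel_open_move C(2) c l(1) by blast
    have "\<forall>q\<in>D. (c + e *\<^sub>R l) \<bullet> q = c \<bullet> q" using l(2) by (simp add: inner_add_left)
    then have "argmin_set X (c + e *\<^sub>R l) = argmin_set X c"
      using D c e(2) unfolding sufficient_dataset_iff by blast
    then have "(c + e *\<^sub>R l) \<bullet> x = (c + e *\<^sub>R l) \<bullet> y" "c \<bullet> x = c \<bullet> y"
      using xy by (metis mem_argmin_set order_antisym)+
    then show ?thesis using e(1) by (simp add: inner_add_left)
  qed
  define R where "R c c' \<longleftrightarrow> (\<forall>x\<in>argmin_set X c. \<forall>x'\<in>argmin_set X c'. l \<bullet> x = l \<bullet> x')" for c c'
  have "R c0 c" if "c \<in> C" for c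
  proof (rule connected_equivalence_relation[OF C(1) c0(1) that])
    show "R z x" if "R x z" for x z
      using that by (simp add: R_def)
    \<comment> \<open>A minimizer for the middle cost \<open>y\<close> links the two equalities,
      hence the need for \<open>nonempty\<close>.\<close>
    show "R x z" if "R x y" "R y z" for x y z
      using that nonempty[of y] unfolding R_def by (metis ex_in_conv)
    show "\<exists>T. openin (top_of_set C) T \<and> c \<in> T \<and> (\<forall>x\<in>T. R c x)" if c: "c \<in> C" for c
    proof -
      obtain T where T: "open T" "c \<in> T" "\<forall>c'\<in>T. argmin_set X c' \<subseteq> argmin_set X c"
        using eventually_argmin_set_subset[OF X, of c] by (auto simp: eventually_nhds)
      \<comment> \<open>For \<open>c'\<close> in \<open>T\<close> every minimizer is also one for
        \<open>c\<close>, so \<open>const\<close> at the single cost \<open>c\<close> compares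
        them.\<close>
      then have "\<forall>c'\<in>C \<inter> T. R c c'" using const[OF c] unfolding R_def by blast
      moreover have "openin (top_of_set C) (C \<inter> T)" using T(1) by (rule openin_open_Int)
      ultimately show ?thesis using T(2) c by blast
    qed
  qed
  then have "\<forall>x\<in>optimal_solutions X C. l \<bullet> x = l \<bullet> a"
    using c0(2) unfolding R_def optimal_solutions_def by (metis UN_E)
  moreover have "a \<in> optimal_solutions X C" using c0 by (auto simp: optimal_solutions_def)
  ultimately show ?thesis using v orthogonal_dir_iff by blast
qed

section \<open>Lower bound by projection onto \<open>dir C\<close>\<close>

lemma inner_orth_proj:
  assumes "subspace W" "l \<in> W"
  shows "l \<bullet> orth_proj W x = l \<bullet> x"
  using orth_proj_props(2)[OF assms(1), of x] assms(2)
  by (auto simp: orthogonal_comp_def orthogonal_def inner_diff_right)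

text \<open>The part \<open>z\<close> of \<open>?P v\<close> orthogonal to \<open>span (?P\<close>
  D)\<open>lies in\<close>dir
  C\<open>and is orthogonal to\<close>D\<open>, hence to\<close>v\<open>by sufficiency. But\<close>z
  \<bullet> v = z \<bullet> ?P v = z \<bullet> z\<open>, so\<close>z = 0\<open>and\<close>?P
  \<open>D\<close> spans the projection of \<open>?V\<close>.\<close>

lemma decision_rank_le_card:
  fixes X C D :: "'a::euclidean_space set"
  assumes X: "polytope X" and C: "connected C" "rel_open C"
    and D: "sufficient_dataset C X D"
  shows "decision_rank X C \<le> card D"
proof -
  let ?P = "orth_proj (dir C)" and ?V = "dir (optimal_solutions X C)"
  have fin: "finite D" using D by (simp add: sufficient_dataset_iff)
  have "?P v \<in> span (?P ` D)" if v: "v \<in> ?V" for v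
  proof -
    obtain y z where yz: "y \<in> span (?P ` D)" "\<And>w. w \<in> span (?P ` D) \<Longrightarrow> orthogonal z w"
        "?P v = y + z"
      using orthogonal_subspace_decomp_exists[of "?P ` D" "?P v"] by metis
    have "span (?P ` D) \<subseteq> dir C"
      by (intro span_minimal) (auto simp: subspace_dir orth_proj_props)
    then have z: "z \<in> dir C"
      using yz(1,3) orth_proj_props(1)[OF subspace_dir, of C v] subspace_diff[OF subspace_dir]
      by (metis add_diff_cancel_left' subsetD)
    have "z \<bullet> q = 0" if "q \<in> D" for q
      using yz(2)[OF span_base, of "?P q"] that inner_orth_proj[OF subspace_dir z, of q]
      by (simp add: orthogonal_def)
    then have "z \<bullet> v = 0" using sufficient_dataset_orthogonal[OF X C D z _ v] by blast
    then have "z \<bullet> (y + z) = 0" using inner_orth_proj[OF subspace_dir z, of v] yz(3) by simp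
    moreover have "z \<bullet> y = 0" using yz(1,2) by (simp add: orthogonal_def)
    ultimately have "z = 0" by (simp add: inner_add_right)
    with yz show ?thesis by simp
  qed
  then have "decision_rank X C \<le> card (?P ` D)"
    unfolding decision_rank_def using fin by (intro dim_le_card) auto
  also have "\<dots> \<le> card D" using fin by (rule card_image_le)
  finally show ?thesis .
qed

section \<open>Upper bound by constructing a dataset inside \<open>Q\<close>\<close>

lemma span_rel_open_two_points:
  fixes Q :: "'a::euclidean_space set"
  assumes "rel_open Q" "q0 \<in> Q" "s \<in> span Q"
  obtains q where "q \<in> Q" "s \<in> span {q0, q}"
proof -
  have "Q \<subseteq> span (insert q0 (dir Q))"
  proof
    fix q assume "q \<in> Q"
    then have "q - q0 \<in> dir Q" using assms(2) by (auto simp: dir_def intro!: span_base)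
    then have "q0 + (q - q0) \<in> span (insert q0 (dir Q))"
      by (intro span_add span_base) auto
    then show "q \<in> span (insert q0 (dir Q))" by simp
  qed
  then have "s \<in> span (insert q0 (dir Q))" using assms(3) span_minimal subspace_span by blast
  then obtain k where "s - k *\<^sub>R q0 \<in> span (dir Q)" using span_breakdown_eq by blast
  then have t: "s - k *\<^sub>R q0 \<in> dir Q" by (simp add: dir_def span_span)
  then obtain e where e: "e > 0" "q0 + e *\<^sub>R (s - k *\<^sub>R q0) \<in> Q" (is "?q \<in> Q")
    using rel_open_move assms(1,2) by blast
  \<comment> \<open>Solving the definition of \<open>?q\<close> for \<open>s\<close>.\<close>
  have "(1 / e) *\<^sub>R (?q - q0) + k *\<^sub>R q0 \<in> span {q0, ?q}"
    by (intro span_add span_scale span_diff span_base) auto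
  then have "s \<in> span {q0, ?q}" using e(1) by simp
  with e(2) show thesis by (rule that)
qed

lemma sufficient_dataset_card_le_Suc_decision_rank:
  fixes X C Q :: "'a::euclidean_space set"
  assumes X: "compact X" and Q: "rel_open Q"
    and V: "dir (optimal_solutions X C) \<subseteq> orthogonal_comp (dir C) + span Q"
  shows "\<exists>D\<subseteq>Q. sufficient_dataset C X D \<and> card D \<le> decision_rank X C + 1"
proof -
  let ?P = "orth_proj (dir C)" and ?V = "dir (optimal_solutions X C)"
  \<comment> \<open>The summand of \<open>v\<close> in \<open>orthogonal_comp (dir C)\<close> is
    invisible to every \<open>l\<close> in \<open>dir C\<close>.\<close>
  have lift: "\<exists>s\<in>span Q. \<forall>l\<in>dir C. l \<bullet> v = l \<bullet> s" if "v \<in> ?V" for v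
    using that V by (force simp: set_plus_def orthogonal_comp_def orthogonal_def inner_add_right)
  show ?thesis
  proof (cases "Q = {}")
    case True
    \<comment> \<open>Here \<open>span Q\<close> is zero, so \<open>lift\<close> makes
      \<open>?V\<close> orthogonal to \<open>dir C\<close>.\<close>
    have "sufficient_dataset C X {}"
      using X lift True by (intro sufficient_datasetI) auto
    with True show ?thesis by auto
  next
    case False
    then obtain q0 where q0: "q0 \<in> Q" by blast
    obtain B where B: "B \<subseteq> ?P ` ?V" "independent B" "?P ` ?V \<subseteq> span B" "card B = dim (?P ` ?V)"
      using basis_exists by blast
    have "\<exists>q\<in>Q. \<exists>s\<in>span {q0, q}. \<forall>l\<in>dir C. l \<bullet> u = l \<bullet> s" if u: "u \<in> B" for u
    proof -
      obtain v where v: "v \<in> ?V" "u = ?P v" using u B(1) by blast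
      then obtain s where s: "s \<in> span Q" "\<forall>l\<in>dir C. l \<bullet> v = l \<bullet> s" using lift by blast
      with v show ?thesis
        using span_rel_open_two_points[OF Q q0 s(1)] inner_orth_proj[OF subspace_dir] by metis
    qed
    then obtain f where f: "\<And>u. u \<in> B \<Longrightarrow> f u \<in> Q"
        "\<And>u. u \<in> B \<Longrightarrow> \<exists>s\<in>span {q0, f u}. \<forall>l\<in>dir C. l \<bullet> u = l \<bullet> s"
      by metis
    \<comment> \<open>The same \<open>q0\<close> serves every basis vector, which costs one point
      beyond the \<open>decision_rank X C\<close> many vectors of \<open>B\<close>.\<close>
    define D where "D = insert q0 (f ` B)"
    have finB: "finite B" using B(2) by (rule independent_imp_finite)
    have "sufficient_dataset C X D"
    proof (rule sufficient_datasetI[OF X])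
      show "finite D" using finB by (simp add: D_def)
      fix l v assume l: "l \<in> dir C" "\<forall>q\<in>D. l \<bullet> q = 0" and v: "v \<in> ?V"
      have "l \<bullet> u = 0" if u: "u \<in> B" for u
      proof -
        have "span {q0, f u} \<subseteq> {s. l \<bullet> s = 0}"
          using l(2) u by (intro span_minimal subspace_hyperplane) (auto simp: D_def)
        with f(2)[OF u] l(1) show ?thesis by auto
      qed
      then have "span B \<subseteq> {u. l \<bullet> u = 0}" by (intro span_minimal subspace_hyperplane) auto
      then have "l \<bullet> ?P v = 0" using v B(3) by blast
      then show "l \<bullet> v = 0" using inner_orth_proj[OF subspace_dir l(1)] by simp
    qed
    moreover have "card D \<le> decision_rank X C + 1"
      using card_image_le[OF finB, of f] B(4)
      by (simp add: D_def decision_rank_def card_insert_if finB)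
    moreover have "D \<subseteq> Q" using q0 f(1) by (auto simp: D_def)
    ultimately show ?thesis by blast
  qed
qed

theorem corollary2:
  fixes A :: "real^'d^'m" and b :: "real^'m"
    and X C Q :: "(real^'d) set"
  assumes X_def: "X = standard_polyhedron A b"
    and bounded_X: "bounded X"
    and C_convex: "convex C"
    and C_rel_open: "rel_open C"
    and Q_rel_open: "rel_open Q"
    and span_condition: "dir (optimal_solutions X C) \<subseteq> orthogonal_comp (dir C) + span Q"
  shows "(\<exists>D. D \<subseteq> Q \<and> sufficient_dataset C X D) \<and>
         (LEAST n. \<exists>D. D \<subseteq> Q \<and> sufficient_dataset C X D \<and> card D = n)
           \<in> {decision_rank X C, decision_rank X C + 1}"
proof -
  let ?S = "\<lambda>n. \<exists>D. D \<subseteq> Q \<and> sufficient_dataset C X D \<and> card D = n"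
  have X: "polytope X"
    using bounded_X polyhedron_standard_polyhedron by (simp add: X_def polytope_eq_bounded_polyhedron)
  obtain D where D: "D \<subseteq> Q" "sufficient_dataset C X D" "card D \<le> decision_rank X C + 1"
    using sufficient_dataset_card_le_Suc_decision_rank[OF polytope_imp_compact[OF X] Q_rel_open span_condition]
    by blast
  then have SD: "?S (card D)" by blast
  \<comment> \<open>The minimum is attained, so the lower bound applies to a dataset of that
    size.\<close>
  then have "?S (Least ?S)" by (rule LeastI)
  then have "decision_rank X C \<le> Least ?S"
    using decision_rank_le_card[OF X convex_connected[OF C_convex] C_rel_open] by metis
  moreover have "Least ?S \<le> card D" using SD by (rule Least_le)
  ultimately have "Least ?S \<in> {decision_rank X C, decision_rank X C + 1}" using D(3) by auto
  with D show ?thesis by blast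
qed

end
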